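(* Let $x\in\mathbb{R}$ be an algebraic number of degree $3$. Then there exist integers $m_1,m_2,m_3,m_4$ with $m_1m_4-m_2m_3\ne 0$, and integers $t_0$ and $a_0\neq 0$, such that the following holds. Put $y:=\frac{m_1x+m_2}{m_3x+m_4}$ and define the sequences (with $t=t_0$, $a=a_0$): $\alpha_0=t$ and, for all integers $k\ge 0$, $$\beta_{4k+1}=3(12k+1)(3k+1)a,\ \alpha_{4k+1}=(8k+3)t^2;\qquad \beta_{4k+2}=3(12k+5)(3k+2)a,\ \alpha_{4k+2}=(8k+5)t;$$ $$\beta_{4k+3}=3(12k+7)(6k+5)a,\ \alpha_{4k+3}=2(8k+7)t^2;\qquad \beta_{4k+4}=3(12k+11)(6k+7)a,\ \alpha_{4k+4}=(8k+9)t.$$ Let $p_0=\alpha_0$, $q_0=1$, $p_1=\alpha_0\alpha_1+\beta_1$, $q_1=\alpha_1$, and $p_n=\alpha_np_{n-1}+\beta_np_{n-2}$, $q_n=\alpha_nq_{n-1}+\beta_nq_{n-2}$ for $n\ge 2$. Then the generalised continued fraction $\alpha_0+\cfrac{\beta_1}{\alpha_1+\cfrac{\beta_2}{\alpha_2+\cdots}}$ converges to $y$, i.e. $q_n\neq0$ for all large $n$ and $p_n/q_n\to y$ as $n\to\infty$. *)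

theory Defs
  imports Complex_Main "HOL-Computational_Algebra.Polynomial"
begin

text \<open>The degree over the rationals of the minimal polynomial; meaningful only for \<open>algebraic x\<close>.\<close>
definition algebraic_degree :: "'a :: field_char_0 \<Rightarrow> nat" where
  "algebraic_degree x =
     (LEAST d. \<exists>p. (\<forall>i. coeff p i \<in> \<rat>) \<and> p \<noteq> 0 \<and> poly p x = 0 \<and> degree p = d)"

text \<open>Numerators and denominators of the convergents of
  \<open>\<alpha> 0 + \<beta> 1 / (\<alpha> 1 + \<beta> 2 / (\<alpha> 2 + \<dots>))\<close>; the value \<open>\<beta> 0\<close> is never used.\<close>
fun gcf_num :: "(nat \<Rightarrow> 'a :: comm_ring_1) \<Rightarrow> (nat \<Rightarrow> 'a) \<Rightarrow> nat \<Rightarrow> 'a" where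
  "gcf_num \<alpha> \<beta> 0 = \<alpha> 0"
| "gcf_num \<alpha> \<beta> (Suc 0) = \<alpha> 0 * \<alpha> 1 + \<beta> 1"
| "gcf_num \<alpha> \<beta> (Suc (Suc n)) =
     \<alpha> (Suc (Suc n)) * gcf_num \<alpha> \<beta> (Suc n) + \<beta> (Suc (Suc n)) * gcf_num \<alpha> \<beta> n"

fun gcf_den :: "(nat \<Rightarrow> 'a :: comm_ring_1) \<Rightarrow> (nat \<Rightarrow> 'a) \<Rightarrow> nat \<Rightarrow> 'a" where
  "gcf_den \<alpha> \<beta> 0 = 1"
| "gcf_den \<alpha> \<beta> (Suc 0) = \<alpha> 1"
| "gcf_den \<alpha> \<beta> (Suc (Suc n)) =
     \<alpha> (Suc (Suc n)) * gcf_den \<alpha> \<beta> (Suc n) + \<beta> (Suc (Suc n)) * gcf_den \<alpha> \<beta> n"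

definition gcf_converges_to :: "(nat \<Rightarrow> int) \<Rightarrow> (nat \<Rightarrow> int) \<Rightarrow> real \<Rightarrow> bool" where
  "gcf_converges_to \<alpha> \<beta> y \<longleftrightarrow>
     (\<forall>\<^sub>F n in sequentially. gcf_den \<alpha> \<beta> n \<noteq> 0) \<and>
     (\<lambda>n. real_of_int (gcf_num \<alpha> \<beta> n) / real_of_int (gcf_den \<alpha> \<beta> n)) \<longlonglongrightarrow> y"

text \<open>An index \<open>n \<ge> 1\<close> is written as \<open>4 * k + r\<close> with \<open>1 \<le> r \<le> 4\<close>; the case distinction
  is on \<open>r - 1 = (n - 1) mod 4\<close>. The value of \<open>cubic_beta\<close> at \<open>0\<close> is a dummy.\<close>
definition cubic_alpha :: "int \<Rightarrow> nat \<Rightarrow> int" where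
  "cubic_alpha t n =
     (if n = 0 then t else
      let k = int ((n - 1) div 4); s = (n - 1) mod 4 in
        if s = 0 then (8 * k + 3) * t\<^sup>2
        else if s = 1 then (8 * k + 5) * t
        else if s = 2 then 2 * (8 * k + 7) * t\<^sup>2
        else (8 * k + 9) * t)"

definition cubic_beta :: "int \<Rightarrow> nat \<Rightarrow> int" where
  "cubic_beta a n =
     (if n = 0 then 0 else
      let k = int ((n - 1) div 4); s = (n - 1) mod 4 in
        if s = 0 then 3 * (12 * k + 1) * (3 * k + 1) * a
        else if s = 1 then 3 * (12 * k + 5) * (3 * k + 2) * a
        else if s = 2 then 3 * (12 * k + 7) * (6 * k + 5) * a
        else 3 * (12 * k + 11) * (6 * k + 7) * a)"

lemma cubic_alpha_eqs:
  "cubic_alpha t 0 = t"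
  "cubic_alpha t (4 * k + 1) = (8 * int k + 3) * t\<^sup>2"
  "cubic_alpha t (4 * k + 2) = (8 * int k + 5) * t"
  "cubic_alpha t (4 * k + 3) = 2 * (8 * int k + 7) * t\<^sup>2"
  "cubic_alpha t (4 * k + 4) = (8 * int k + 9) * t"
proof -
  have "(4 * k + 1) div 4 = k" "(4 * k + 1) mod 4 = 1" "(4 * k + 2) div 4 = k" "(4 * k + 2) mod 4 = 2"
       "(4 * k + 3) div 4 = k" "(4 * k + 3) mod 4 = 3" by presburger+
  moreover have "4 * k + 2 - 1 = 4 * k + 1" "4 * k + 3 - 1 = 4 * k + 2" "4 * k + 4 - 1 = 4 * k + 3"
    by simp_all
  ultimately show
    "cubic_alpha t 0 = t"
    "cubic_alpha t (4 * k + 1) = (8 * int k + 3) * t\<^sup>2"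
    "cubic_alpha t (4 * k + 2) = (8 * int k + 5) * t"
    "cubic_alpha t (4 * k + 3) = 2 * (8 * int k + 7) * t\<^sup>2"
    "cubic_alpha t (4 * k + 4) = (8 * int k + 9) * t"
    unfolding cubic_alpha_def Let_def by simp_all
qed

lemma cubic_beta_eqs:
  "cubic_beta a (4 * k + 1) = 3 * (12 * int k + 1) * (3 * int k + 1) * a"
  "cubic_beta a (4 * k + 2) = 3 * (12 * int k + 5) * (3 * int k + 2) * a"
  "cubic_beta a (4 * k + 3) = 3 * (12 * int k + 7) * (6 * int k + 5) * a"
  "cubic_beta a (4 * k + 4) = 3 * (12 * int k + 11) * (6 * int k + 7) * a"
proof -
  have "(4 * k + 1) div 4 = k" "(4 * k + 1) mod 4 = 1" "(4 * k + 2) div 4 = k" "(4 * k + 2) mod 4 = 2"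
       "(4 * k + 3) div 4 = k" "(4 * k + 3) mod 4 = 3" by presburger+
  moreover have "4 * k + 2 - 1 = 4 * k + 1" "4 * k + 3 - 1 = 4 * k + 2" "4 * k + 4 - 1 = 4 * k + 3"
    by simp_all
  ultimately show
    "cubic_beta a (4 * k + 1) = 3 * (12 * int k + 1) * (3 * int k + 1) * a"
    "cubic_beta a (4 * k + 2) = 3 * (12 * int k + 5) * (3 * int k + 2) * a"
    "cubic_beta a (4 * k + 3) = 3 * (12 * int k + 7) * (6 * int k + 5) * a"
    "cubic_beta a (4 * k + 4) = 3 * (12 * int k + 11) * (6 * int k + 7) * a"
    unfolding cubic_beta_def Let_def by simp_all
qed

end

theory Submission
  imports Defs
begin

text \<open>
  Write \<open>y = t u\<close> and \<open>z = a / t ^ 3\<close>. The continued fraction is an expansion in powers of \<open>z\<close> of the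
  root \<open>u\<close> near \<open>1\<close> of \<open>u ^ 3 - u ^ 2 = z\<close>. The error \<open>P n - u * Q n\<close> of the \<open>n\<close>-th normalised
  convergent satisfies the same three-term recurrence as \<open>P n\<close> and \<open>Q n\<close>, and for \<open>n = 2 k\<close> it
  equals, up to a constant, \<open>(u - 1) ^ (2 k + 1) u ^ k F((u - 1) / u)\<close> with the hypergeometric
  polynomial \<open>F(x) = \<^sub>2F\<^sub>1(-k, 3k + 3; 2k + 5/2; x/4)\<close>; this amounts to a contiguous relation between
  three such polynomials. For \<open>u\<close> close to \<open>1\<close> crude bounds then show that the error divided by
  \<open>Q n\<close> tends to \<open>0\<close>.

  It remains to find \<open>y\<close> in the orbit of \<open>x\<close> with \<open>y ^ 3 - t y ^ 2 - a = 0\<close> and \<open>y / t\<close> close to \<open>1\<close>.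
  With \<open>y = l / w\<close> for an integer \<open>l\<close> clearing denominators, this means that \<open>w\<close> is a root of a
  depressed rational cubic \<open>w ^ 3 + p w + q\<close> with \<open>w ^ 2 / p\<close> small.
\<close>

subsection \<open>A contiguous relation for hypergeometric polynomials\<close>

text \<open>The coefficients of \<open>\<^sub>2F\<^sub>1(-k, 3k + 3; 2k + 5/2; x/4)\<close>.\<close>
definition hyp_coeff :: "real \<Rightarrow> nat \<Rightarrow> real" where
  "hyp_coeff k j = pochhammer (- k) j * pochhammer (3*k+3) j / (pochhammer (2*k+5/2) j * fact j * 4^j)"

text \<open>This is the coefficient of \<open>x^(j+4)\<close> in the three-term relation of
  \<open>poly_hyp_poly_rec\<close>, which explains the shifts. All terms are rational multiples of
  one hypergeometric term, so a polynomial identity in \<open>k\<close> and \<open>j\<close>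
  remains. Taking \<open>k\<close> real makes it accessible to field arithmetic.\<close>

lemma hyp_coeff_contiguous:
  fixes k :: real
  assumes k: "k \<ge> 0"
  shows "(9*(6*k+13)*(3*k+8)*(6*k+11)*(3*k+7)/(4*(4*k+11)*(4*k+9)^2*(4*k+7))) * hyp_coeff (k+2) (j+2) =
     hyp_coeff (k+1) (j+4) - 3 * hyp_coeff (k+1) (j+3) + 3 * hyp_coeff (k+1) (j+2) - hyp_coeff (k+1) (j+1)
     + (3*(6*k+11)*(3*k+7)/(2*(4*k+9)*(4*k+7)) + 3*(6*k+7)*(3*k+5)/(2*(4*k+5)*(4*k+7))) * hyp_coeff (k+1) (j+3)
     - hyp_coeff k (j+4)"
proof -
  define A where "A = pochhammer (-k) j"
  define B where "B = pochhammer (3*k+6) (j+1)"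
  define C where "C = pochhammer (2*k+9/2) (j+1)"
  define T where "T = A * B / (C * fact (j+1) * 4^(j+1))"
  define J where "J = real j"
  have J0: "J \<ge> 0" by (simp add: J_def)
  have Cpos: "C > 0" unfolding C_def by (rule pochhammer_pos) (use k in simp)
  have pS: "pochhammer a (Suc n) = a * pochhammer (a+1) n" for a :: real and n
    using pochhammer_rec[of a n] by simp
  have e: "j+1 = Suc j" "j+2 = Suc (Suc j)" "j+3 = Suc (Suc (Suc j))" "j+4 = Suc (Suc (Suc (Suc j)))" by simp_all
  note pR = pochhammer_Suc
  \<comment> \<open>\<open>st\<close> appends a factor at the upper end of a Pochhammer product,
    \<open>sp\<close> prepends one at the lower end. All products below are reached from
    \<open>A\<close>, \<open>B\<close>, \<open>C\<close> in this way.\<close>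
  have st: "pochhammer a m = X * Y" if "pochhammer a n = X" "m = Suc n" "Y = a + real n" for a X Y :: real and m n
    using that by (simp add: pR)
  have sp: "pochhammer a m = a * X" if "pochhammer b n = X" "m = Suc n" "b = a + 1" for a b X :: real and m n
    using that by (simp add: pS)
  have A1: "pochhammer (-(k+1)) (j+1) = -(k+1) * A"
    using pS[of "-(k+1)" j] by (simp add: A_def)
  have A6: "pochhammer (-k) (j+4) = A * (J-k) * (J-k+1) * (J-k+2) * (J-k+3)"
    by (simp add: e pR J_def A_def algebra_simps)
  have A2: "pochhammer (-(k+1)) (j+2) = -(k+1) * A * (J-k)"
    by (rule st[OF A1]) (simp_all add: J_def)
  have A3: "pochhammer (-(k+1)) (j+3) = -(k+1) * A * (J-k) * (J-k+1)"
    by (rule st[OF A2]) (simp_all add: J_def)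
  have A4: "pochhammer (-(k+1)) (j+4) = -(k+1) * A * (J-k) * (J-k+1) * (J-k+2)"
    by (rule st[OF A3]) (simp_all add: J_def)
  have A5: "pochhammer (-(k+2)) (j+2) = (k+2)*(k+1) * A"
    by (subst sp[OF A1, of _ "-(k+2)"]) (simp_all add: algebra_simps)
  have B1: "pochhammer (3*(k+1)+3) (j+1) = B" by (simp add: B_def algebra_simps)
  have B2: "pochhammer (3*(k+1)+3) (j+2) = B * (3*k+7+J)"
    by (rule st[OF B1]) (simp_all add: J_def)
  have B3: "pochhammer (3*(k+1)+3) (j+3) = B * (3*k+7+J) * (3*k+8+J)"
    by (rule st[OF B2]) (simp_all add: J_def)
  have B4: "pochhammer (3*(k+1)+3) (j+4) = B * (3*k+7+J) * (3*k+8+J) * (3*k+9+J)"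
    by (rule st[OF B3]) (simp_all add: J_def)
  have B6: "pochhammer (3*k+3) (j+4) = (3*k+3)*(3*k+4)*(3*k+5)*B"
  proof -
    have h1: "pochhammer (3*k+5) (j+2) = (3*k+5)*B"
      by (rule sp[OF B1]) simp_all
    have h2: "pochhammer (3*k+4) (j+3) = (3*k+4)*((3*k+5)*B)"
      by (rule sp[OF h1]) simp_all
    have "pochhammer (3*k+3) (j+4) = (3*k+3)*((3*k+4)*((3*k+5)*B))"
      by (rule sp[OF h2]) simp_all
    thus ?thesis by simp
  qed
  have B5: "pochhammer (3*(k+2)+3) (j+2) = B * (3*k+7+J) * (3*k+8+J) * (3*k+9+J) * (3*k+10+J) / ((3*k+6)*(3*k+7)*(3*k+8))"
  proof -
    \<comment> \<open>The product of length \<open>j+5\<close> starting at \<open>3*k+6\<close> is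
      computed twice: by extending \<open>B4\<close> upwards and by splitting off its three lowest
      factors. \<open>C5\<close> uses the same device.\<close>
    have "pochhammer (3*(k+1)+3) (j+5) = B * (3*k+7+J) * (3*k+8+J) * (3*k+9+J) * (3*k+10+J)"
      by (rule st[OF B4]) (simp_all add: J_def)
    moreover
    have h1: "pochhammer (3*k+8) (j+3) = (3*k+8) * pochhammer (3*(k+2)+3) (j+2)"
      by (rule sp[OF refl]) simp_all
    have h2: "pochhammer (3*k+7) (j+4) = (3*k+7) * ((3*k+8) * pochhammer (3*(k+2)+3) (j+2))"
      by (rule sp[OF h1]) simp_all
    have "pochhammer (3*(k+1)+3) (j+5) = (3*(k+1)+3)*((3*k+7)*((3*k+8) * pochhammer (3*(k+2)+3) (j+2)))"
      by (rule sp[OF h2]) simp_all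
    ultimately have "pochhammer (3*(k+2)+3) (j+2) * ((3*k+6)*(3*k+7)*(3*k+8)) = B * (3*k+7+J) * (3*k+8+J) * (3*k+9+J) * (3*k+10+J)"
      by (simp add: algebra_simps)
    thus ?thesis using k by (simp add: eq_divide_eq)
  qed
  have C1: "pochhammer (2*(k+1)+5/2) (j+1) = C" by (simp add: C_def algebra_simps)
  have C2: "pochhammer (2*(k+1)+5/2) (j+2) = C * (2*k+11/2+J)"
    by (rule st[OF C1]) (simp_all add: J_def)
  have C3: "pochhammer (2*(k+1)+5/2) (j+3) = C * (2*k+11/2+J) * (2*k+13/2+J)"
    by (rule st[OF C2]) (simp_all add: J_def)
  have C4: "pochhammer (2*(k+1)+5/2) (j+4) = C * (2*k+11/2+J) * (2*k+13/2+J) * (2*k+15/2+J)"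
    by (rule st[OF C3]) (simp_all add: J_def)
  have C5: "pochhammer (2*(k+2)+5/2) (j+2) = C * (2*k+11/2+J) * (2*k+13/2+J) * (2*k+15/2+J) / ((2*k+9/2)*(2*k+11/2))"
  proof -
    have h1: "pochhammer (2*k+11/2) (j+3) = (2*k+11/2) * pochhammer (2*(k+2)+5/2) (j+2)"
      by (rule sp[OF refl]) simp_all
    have "pochhammer (2*(k+1)+5/2) (j+4) = (2*(k+1)+5/2)*((2*k+11/2) * pochhammer (2*(k+2)+5/2) (j+2))"
      by (rule sp[OF h1]) simp_all
    moreover have e9: "2*(k+1)+5/2 = 2*k+9/2" by simp
    ultimately have "pochhammer (2*(k+2)+5/2) (j+2) * ((2*k+9/2)*(2*k+11/2)) = C * (2*k+11/2+J) * (2*k+13/2+J) * (2*k+15/2+J)"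
      using C4 by (simp only: e9 mult_ac)
    thus ?thesis using k by (simp add: eq_divide_eq)
  qed
  have C6: "pochhammer (2*k+5/2) (j+4) = (2*k+5/2)*(2*k+7/2) * (C * (2*k+11/2+J))"
  proof -
    have h1: "pochhammer (2*k+7/2) (j+3) = (2*k+7/2) * (C * (2*k+11/2+J))"
      by (rule sp[OF C2]) simp_all
    have "pochhammer (2*k+5/2) (j+4) = (2*k+5/2)*((2*k+7/2) * (C * (2*k+11/2+J)))"
      by (rule sp[OF h1]) simp_all
    thus ?thesis by simp
  qed
  have F2: "fact (j+2) = fact (j+1) * (J+2)" and F3: "fact (j+3) = fact (j+1) * (J+2) * (J+3)"
    and F4: "fact (j+4) = fact (j+1) * (J+2) * (J+3) * (J+4)" 
    by (simp_all add: e J_def algebra_simps)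
  have P: "(4::real)^(j+2) = 4^(j+1)*4" "(4::real)^(j+3) = 4^(j+1)*16" "(4::real)^(j+4) = 4^(j+1)*64"
    by (simp_all add: power_add)
  define c1 where "c1 = 2*k+11/2+J"
  define c2 where "c2 = 2*k+13/2+J"
  define c3 where "c3 = 2*k+15/2+J"
  have nz: "c1 > 0" "c2 > 0" "c3 > 0" using k J0 by (simp_all add: c1_def c2_def c3_def)
  \<comment> \<open>Dividing by all denominators that arise up to index \<open>j+4\<close> makes
    \<open>D1\<close> to \<open>D4\<close> polynomial multiples of \<open>R\<close>. In
    \<open>D5\<close> and \<open>D6\<close> only factors depending on \<open>k\<close> alone remain
    to be cleared.\<close>
  define R where "R = T / (64*(J+2)*(J+3)*(J+4)*c1*c2*c3)"
  have D1: "hyp_coeff (k+1) (j+1) = R * (-(k+1)) * (64*(J+2)*(J+3)*(J+4)*c1*c2*c3)"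
    unfolding hyp_coeff_def A1 B1 C1 R_def T_def using nz J0 Cpos by (simp add: divide_simps) (simp add: algebra_simps)?
  have D2: "hyp_coeff (k+1) (j+2) = R * (-(k+1)) * (J-k) * (3*k+7+J) * (16*(J+3)*(J+4)*c2*c3)"
    unfolding hyp_coeff_def A2 B2 C2 F2 P R_def T_def c1_def[symmetric] using nz J0 Cpos by (simp add: divide_simps) (simp add: algebra_simps)?
  have D3: "hyp_coeff (k+1) (j+3) = R * (-(k+1)) * (J-k) * (J-k+1) * (3*k+7+J) * (3*k+8+J) * (4*(J+4)*c3)"
    unfolding hyp_coeff_def A3 B3 C3 F3 P R_def T_def c1_def[symmetric] c2_def[symmetric] using nz J0 Cpos by (simp add: divide_simps) (simp add: algebra_simps)?
  have D4: "hyp_coeff (k+1) (j+4) = R * (-(k+1)) * (J-k) * (J-k+1) * (J-k+2) * (3*k+7+J) * (3*k+8+J) * (3*k+9+J)"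
    unfolding hyp_coeff_def A4 B4 C4 F4 P R_def T_def c1_def[symmetric] c2_def[symmetric] c3_def[symmetric]
    using nz J0 Cpos by (simp add: divide_simps) (simp add: algebra_simps)?
  have D5: "hyp_coeff (k+2) (j+2) * (12*(3*k+7)*(3*k+8)) = R * (k+1) * (3*k+7+J) * (3*k+8+J) * (3*k+9+J) * (3*k+10+J) * ((4*k+9)*(4*k+11)) * (16*((J+3)*(J+4)))"
    unfolding hyp_coeff_def A5 B5 C5 F2 P R_def T_def c1_def[symmetric] c2_def[symmetric] c3_def[symmetric]
    using nz J0 Cpos k by (simp add: divide_simps) (simp add: algebra_simps)?
  have D6: "hyp_coeff k (j+4) * ((4*k+5)*(4*k+7)) = R * (J-k) * (J-k+1) * (J-k+2) * (J-k+3) * ((3*k+3)*(3*k+4)*(3*k+5)) * (4*c2*c3)"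
    unfolding hyp_coeff_def A6 B6 C6 F4 P R_def T_def c1_def[symmetric] c2_def[symmetric] c3_def[symmetric]
    using nz J0 Cpos k by (simp add: divide_simps) (simp add: algebra_simps)?
  define K5 K7 K9 where "K5 = 4*k+5" and "K7 = 4*k+7" and "K9 = 4*k+9"
  have Kp: "K5 > 0" "K7 > 0" "K9 > 0" using k by (simp_all add: K5_def K7_def K9_def)
  define U where "U = R * (k+1) * (3*k+7+J) * (3*k+8+J)"
  define V where "V = R * (J-k) * (J-k+1)"
  have L: "(9*(6*k+13)*(3*k+8)*(6*k+11)*(3*k+7)/(4*(4*k+11)*(4*k+9)^2*(4*k+7))) * hyp_coeff (k+2) (j+2)
     = 3*(6*k+13)*(6*k+11)/(K9*K7) * (R * (k+1) * (3*k+7+J) * (3*k+8+J) * (3*k+9+J) * (3*k+10+J) * ((J+3)*(J+4)))"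
  proof -
    have *: "9*a*m8*b*m7/(4*K11*L9^2*L7) * c = 3*a*b/(L9*L7) * (X*Y)"
      if "c * (12*m7*m8) = X * (L9*K11) * (16*Y)" "L7 > 0" "L9 > 0" "K11 > 0" for a b c m7 m8 L7 L9 K11 X Y :: real
    proof -
      have "9*a*m8*b*m7/(4*K11*L9^2*L7) * c = 3*a*b * (c * (12*m7*m8)) / (16*K11*L9^2*L7)"
        by (simp add: mult_ac)
      also have "\<dots> = 3*a*b/(L9*L7) * (X*Y)"
        unfolding that(1) using that(2-4) by (simp add: divide_simps power2_eq_square)
      finally show ?thesis .
    qed
    show ?thesis unfolding K7_def K9_def
      by (rule *[OF D5]) (use k in simp_all)
  qed
  have M: "hyp_coeff k (j+4) = R * (J-k) * (J-k+1) * (J-k+2) * (J-k+3) * ((3*k+3)*(3*k+4)*(3*k+5)) * (4*c2*c3) / (K5*K7)"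
    using D6 Kp unfolding K5_def K7_def by (simp add: eq_divide_eq)
  have N: "(3*(6*k+11)*(3*k+7)/(2*(4*k+9)*(4*k+7)) + 3*(6*k+7)*(3*k+5)/(2*(4*k+5)*(4*k+7)))
     = 3*((6*k+11)*(3*k+7)*K5 + (6*k+7)*(3*k+5)*K9) / (2*K5*K7*K9)"
    using Kp unfolding K5_def[symmetric] K7_def[symmetric] K9_def[symmetric]
    by (simp add: divide_simps) (simp add: algebra_simps)
  \<comment> \<open>The claim times \<open>K5*K7*K9\<close>, a polynomial identity in
    \<open>R\<close>, \<open>k\<close> and \<open>J\<close>.\<close>
  have "3*(6*k+13)*(6*k+11)*K5 * (R * (k+1) * (3*k+7+J) * (3*k+8+J) * (3*k+9+J) * (3*k+10+J) * ((J+3)*(J+4)))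
    = K5*K7*K9*(hyp_coeff (k+1) (j+4) - 3 * hyp_coeff (k+1) (j+3) + 3 * hyp_coeff (k+1) (j+2) - hyp_coeff (k+1) (j+1))
     + 3*((6*k+11)*(3*k+7)*K5 + (6*k+7)*(3*k+5)*K9) * (hyp_coeff (k+1) (j+3) / 2)
     - K9 * (R * (J-k) * (J-k+1) * (J-k+2) * (J-k+3) * ((3*k+3)*(3*k+4)*(3*k+5)) * (4*c2*c3))"
    unfolding D1 D2 D3 D4 K5_def K7_def K9_def c1_def c2_def c3_def
    by algebra
  moreover have "q/(K9*K7)*W = X + 3*n/(2*K5*K7*K9)*c - Y/(K5*K7)"
    if "q*K5*W = K5*K7*K9*X + 3*n*(c/2) - K9*Y" for q W X n c Y :: real
  proof -
    have "q/(K9*K7)*W = (q*K5*W)/(K5*K7*K9)" using Kp by (simp add: divide_simps)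
    also have "\<dots> = X + 3*n/(2*K5*K7*K9)*c - Y/(K5*K7)"
      unfolding that using Kp by (simp add: divide_simps)
    finally show ?thesis .
  qed
  ultimately show ?thesis unfolding L M N by blast
qed

text \<open>The coefficients of \<open>x^0\<close> to \<open>x^3\<close> in the same relation, where
  terms with a negative index are absent.\<close>

lemma hyp_coeff_contiguous_initial:
  fixes k :: real
  assumes k: "k \<ge> 0"
  defines "\<rho> \<equiv> (9*(6*k+13)*(3*k+8)*(6*k+11)*(3*k+7)/(4*(4*k+11)*(4*k+9)^2*(4*k+7)))"
  defines "b \<equiv> (3*(6*k+11)*(3*k+7)/(2*(4*k+9)*(4*k+7)) + 3*(6*k+7)*(3*k+5)/(2*(4*k+5)*(4*k+7)))"
  shows "0 = hyp_coeff (k+1) 0 - hyp_coeff k 0"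
    and "0 = hyp_coeff (k+1) 1 - 3 * hyp_coeff (k+1) 0 + b * hyp_coeff (k+1) 0 - hyp_coeff k 1"
    and "\<rho> * hyp_coeff (k+2) 0 = hyp_coeff (k+1) 2 - 3 * hyp_coeff (k+1) 1 + 3 * hyp_coeff (k+1) 0 + b * hyp_coeff (k+1) 1 - hyp_coeff k 2"
    and "\<rho> * hyp_coeff (k+2) 1 = hyp_coeff (k+1) 3 - 3 * hyp_coeff (k+1) 2 + 3 * hyp_coeff (k+1) 1 - hyp_coeff (k+1) 0 + b * hyp_coeff (k+1) 2 - hyp_coeff k 3"
  subgoal by (simp add: hyp_coeff_def)
  subgoal using k unfolding hyp_coeff_def b_def by (simp add: numeral_eq_Suc pochhammer_Suc divide_simps) (simp add: algebra_simps)?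
  subgoal using k unfolding hyp_coeff_def b_def \<rho>_def by (simp add: numeral_eq_Suc pochhammer_Suc divide_simps power2_eq_square)  (simp add: algebra_simps)?
  subgoal using k unfolding hyp_coeff_def b_def \<rho>_def by (simp add: numeral_eq_Suc pochhammer_Suc divide_simps power2_eq_square) (simp add: algebra_simps)?
  done

section \<open>The hypergeometric polynomials: recurrence and size\<close>

lemma hyp_coeff_eq_0: "k < j \<Longrightarrow> hyp_coeff (real k) j = 0"
  by (simp add: hyp_coeff_def pochhammer_of_nat_eq_0_lemma)

text \<open>The whole hypergeometric series: the factor \<open>pochhammer (- k) j\<close> vanishes
  for \<open>j > k\<close>.\<close>

definition hyp_poly :: "nat \<Rightarrow> real poly" where
  "hyp_poly k = (\<Sum>j\<le>k. monom (hyp_coeff (real k) j) j)"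

lemma coeff_hyp_poly: "coeff (hyp_poly k) j = hyp_coeff (real k) j"
  by (simp add: hyp_poly_def coeff_sum hyp_coeff_eq_0)

text \<open>Comparison of coefficients; the cubic factor is \<open>(1-x)^3 + b*x\<close>, and the
  two outer \<open>pCons 0\<close> stand for \<open>x^2\<close>.\<close>

lemma hyp_poly_rec:
  fixes n :: nat
  defines "k \<equiv> real n"
  defines "\<rho> \<equiv> (9*(6*k+13)*(3*k+8)*(6*k+11)*(3*k+7)/(4*(4*k+11)*(4*k+9)^2*(4*k+7)))"
  defines "b \<equiv> (3*(6*k+11)*(3*k+7)/(2*(4*k+9)*(4*k+7)) + 3*(6*k+7)*(3*k+5)/(2*(4*k+5)*(4*k+7)))"
  shows "pCons 0 (pCons 0 (smult \<rho> (hyp_poly (n+2)))) = [:1, b - 3, 3, -1:] * hyp_poly (n+1) - hyp_poly n"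
proof (rule poly_eqI)
  fix j :: nat
  have k0: "k \<ge> 0" by (simp add: k_def)
  note small = hyp_coeff_contiguous_initial[OF k0, folded \<rho>_def b_def]
  define P2 P1 P0 where "P2 = hyp_poly (n+2)" and "P1 = hyp_poly (n+1)" and "P0 = hyp_poly n"
  have cf: "coeff P2 i = hyp_coeff (k+2) i" "coeff P1 i = hyp_coeff (k+1) i" "coeff P0 i = hyp_coeff k i" for i
    by (simp_all add: P2_def P1_def P0_def coeff_hyp_poly k_def add.commute)
  note fl = P2_def[symmetric] P1_def[symmetric] P0_def[symmetric]
  consider "j = 0" | "j = 1" | "j = 2" | "j = 3" | i where "j = i + 4"
proof -
    have "j = 0 \<or> j = 1 \<or> j = 2 \<or> j = 3 \<or> (\<exists>i. j = i + 4)" by presburger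
    thus thesis using that by blast
  qed
  thus "coeff (pCons 0 (pCons 0 (smult \<rho> (hyp_poly (n+2))))) j = coeff ([:1, b - 3, 3, -1:] * hyp_poly (n+1) - hyp_poly n) j"
  proof cases
    case 1
    thus ?thesis using small(1) unfolding fl by (simp add: cf)
  next
    case 2
    thus ?thesis using small(2) unfolding fl by (simp add: cf algebra_simps)
  next
    case 3
    thus ?thesis using small(3) unfolding fl by (simp add: cf algebra_simps numeral_eq_Suc)
  next
    case 4
    thus ?thesis using small(4) unfolding fl by (simp add: cf algebra_simps numeral_eq_Suc)
  next
    case 5
    thus ?thesis using hyp_coeff_contiguous[OF k0, of i, folded \<rho>_def b_def] 
      unfolding fl by (simp add: cf algebra_simps numeral_eq_Suc)
  qed
qed

lemma poly_hyp_poly_rec: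
  fixes n :: nat and x :: real
  defines "k \<equiv> real n"
  defines "\<rho> \<equiv> (9*(6*k+13)*(3*k+8)*(6*k+11)*(3*k+7)/(4*(4*k+11)*(4*k+9)^2*(4*k+7)))"
  defines "b \<equiv> (3*(6*k+11)*(3*k+7)/(2*(4*k+9)*(4*k+7)) + 3*(6*k+7)*(3*k+5)/(2*(4*k+5)*(4*k+7)))"
  shows "x^2 * \<rho> * poly (hyp_poly (n+2)) x = ((1-x)^3 + b*x) * poly (hyp_poly (n+1)) x - poly (hyp_poly n) x"
proof -
  have "poly (pCons 0 (pCons 0 (smult \<rho> (hyp_poly (n+2))))) x = poly ([:1, b - 3, 3, -1:] * hyp_poly (n+1) - hyp_poly n) x"
    using hyp_poly_rec[of n] unfolding k_def b_def \<rho>_def by simp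
  thus ?thesis by (simp add: algebra_simps power2_eq_square power3_eq_cube)
qed

text \<open>Factor by factor \<open>3*k+3+j\<close> is at most \<open>3/2\<close> times
  \<open>2*k+5/2+j\<close>. With the division by \<open>4^j\<close> the \<open>j\<close>-th
  coefficient is at most \<open>(3/8)^j\<close> times the binomial coefficient in absolute value,
  and the binomial coefficients sum to \<open>2^k\<close>.\<close>

lemma hyp_poly_bound:
  assumes "\<bar>x\<bar> \<le> 1"
  shows "\<bar>poly (hyp_poly k) x\<bar> \<le> 2 ^ k"
proof -
  have "pochhammer (3*real k+3) j \<le> (3/2)^j * pochhammer (2*real k+5/2) j" for j
  proof (induction j)
    case (Suc j)
    have "pochhammer (3*real k+3) j * (3*real k + 3 + real j) \<le> ((3/2)^j * pochhammer (2*real k+5/2) j) * (3/2*(2*real k+5/2+real j))"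
      by (intro mult_mono Suc mult_nonneg_nonneg pochhammer_nonneg) auto
    also have "\<dots> = (3/2)^Suc j * pochhammer (2*real k+5/2) (Suc j)"
      by (simp add: pochhammer_Suc)
    finally show ?case by (simp add: pochhammer_Suc)
  qed auto
  hence *: "pochhammer (3*real k+3) j / pochhammer (2*real k+5/2) j \<le> (3/2)^j" for j
    by (subst pos_divide_le_eq) (auto intro!: pochhammer_pos)
  have c: "\<bar>hyp_coeff (real k) j\<bar> \<le> real (k choose j)" for j
  proof -
    have "pochhammer (- real k) j / fact j = (-1)^j * real (k choose j)"
      by (simp add: binomial_gbinomial gbinomial_pochhammer)
    hence "hyp_coeff (real k) j = (-1)^j * real (k choose j) * (pochhammer (3*real k+3) j / pochhammer (2*real k+5/2) j) / 4^j"
      by (simp add: hyp_coeff_def field_simps)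
    hence "\<bar>hyp_coeff (real k) j\<bar> = real (k choose j) * (pochhammer (3*real k+3) j / pochhammer (2*real k+5/2) j) / 4^j"
      by (simp add: abs_mult power_abs pochhammer_nonneg abs_of_nonneg)
    also have "\<dots> \<le> real (k choose j) * (3/2)^j / 4^j"
      by (intro divide_right_mono mult_left_mono *) auto
    also have "\<dots> = real (k choose j) * (3/8)^j" by (simp add: power_divide flip: power_mult_distrib)
    also have "\<dots> \<le> real (k choose j) * 1" by (intro mult_left_mono power_le_one) auto
    finally show ?thesis by simp
  qed
  have "\<bar>poly (hyp_poly k) x\<bar> = \<bar>\<Sum>j\<le>k. hyp_coeff (real k) j * x^j\<bar>"
    by (simp add: hyp_poly_def poly_sum poly_monom)
  also have "\<dots> \<le> (\<Sum>j\<le>k. \<bar>hyp_coeff (real k) j * x^j\<bar>)" by (rule sum_abs)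
  also have "\<dots> \<le> (\<Sum>j\<le>k. real (k choose j) * 1)"
    unfolding abs_mult power_abs by (intro sum_mono mult_mono c power_le_one assms) auto
  also have "\<dots> = 2^k" by (simp add: choose_row_sum flip: of_nat_sum)
  finally show ?thesis .
qed

subsection \<open>The normalised continued fraction\<close>

text \<open>The partial denominators and, up to the factor \<open>z = a / t ^ 3\<close>, the partial numerators
  that remain after dividing out the factors \<open>cubic_scale t n\<close> below; the four residue classes
  of the original coefficients then collapse to the parity of \<open>n\<close>.\<close>
abbreviation nalpha :: "nat \<Rightarrow> real" where "nalpha n \<equiv> 2 * real n + 1"

definition nbeta :: "nat \<Rightarrow> real" where
  "nbeta n = (if even n then 3 * (3 * real n - 1) * (3 * real n + 2) / 4
              else 3 * (3 * real n - 2) * (3 * real n + 1) / 4)"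

lemma nbeta_nonneg: "n \<ge> 1 \<Longrightarrow> nbeta n \<ge> 0"
  by (auto simp: nbeta_def)

text \<open>The bound is twice the product of the partial denominators \<open>nalpha (n+2)\<close>
  and \<open>nalpha (n+1)\<close>; equality holds at \<open>n = 0\<close>.\<close>

lemma nbeta_le: "nbeta (n + 2) \<le> 2 * (2 * real n + 5) * (2 * real n + 3)"
  by (simp add: nbeta_def field_simps)

text \<open>The start \<open>-1\<close> makes \<open>even_err u 0\<close> equal to
  \<open>1 - u\<close>, the error of the zeroth convergent.\<close>

fun err_const :: "nat \<Rightarrow> real" where
  "err_const 0 = -1"
| "err_const (Suc k) = err_const k * (nbeta (2*k+3) * nbeta (2*k+2) / ((4*real k+7) * (4*real k+5)))"

definition even_err :: "real \<Rightarrow> nat \<Rightarrow> real" where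
  "even_err u k = err_const k * (u - 1) ^ (2*k+1) * u ^ k * poly (hyp_poly k) ((u - 1) / u)"

text \<open>The three-term recurrence with the odd indices eliminated: the inner quotient is the
  error at \<open>2*k+1\<close>, obtained by solving the recurrence backwards, and the bracket
  around it is the error at \<open>2*k+3\<close>. It is the contiguous relation at
  \<open>x = (u-1)/u\<close>.\<close>

lemma even_err_rec:
  fixes u :: real
  assumes u: "u \<noteq> 0"
  defines "z \<equiv> u^3 - u^2"
  defines "D \<equiv> even_err u"
  shows "D (k+2) - nbeta (2*k+4) * z * D (k+1) =
     (4*real k+9) * ((4*real k+7) * D (k+1) + nbeta (2*k+3) * z * ((D (k+1) - nbeta (2*k+2) * z * D k) / (4*real k+5)))"
proof -
  define A2 A3 A4 A5 where "A2 = 4*real k+5" and "A3 = 4*real k+7" and "A4 = 4*real k+9" and "A5 = 4*real k+11"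
  define B2 B3 B4 B5 where "B2 = nbeta (2*k+2)" and "B3 = nbeta (2*k+3)" and "B4 = nbeta (2*k+4)" and "B5 = nbeta (2*k+5)"
  note Adefs = A2_def A3_def A4_def A5_def
  have pos: "A2 > 0" "A3 > 0" "A4 > 0" "A5 > 0" by (simp_all add: Adefs)
  define s where "s = u - 1"
  define x where "x = s / u"
  have z: "z = s * u^2" by (simp add: z_def s_def algebra_simps power2_eq_square power3_eq_cube)
  define F2 F1 F0 where "F2 = poly (hyp_poly (k+2)) x" and "F1 = poly (hyp_poly (k+1)) x" and "F0 = poly (hyp_poly k) x"
  \<comment> \<open>The coefficients of the contiguous relation, now recognised as combinations of
    the partial numerators \<open>B2\<close> to \<open>B5\<close> and denominators \<open>A2\<close>
    to \<open>A5\<close>.\<close>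
  define \<rho> b where "\<rho> = B5*B4 / (A5*A4^2*A3)" and "b = B4/(A4*A3) + B3/(A2*A3)"
  have B: "B2 = 3 * (6 * real k + 5) * (3 * real k + 4) / 2" "B3 = 3 * (6 * real k + 7) * (3 * real k + 5) / 2"
     "B4 = 3 * (6 * real k + 11) * (3 * real k + 7) / 2" "B5 = 3 * (6 * real k + 13) * (3 * real k + 8) / 2"
    by (simp_all add: B2_def B3_def B4_def B5_def nbeta_def field_simps)
  have "x^2 * \<rho> * F2 = ((1-x)^3 + b*x) * F1 - F0"
  proof -
    have "\<rho> = (9*(6*real k+13)*(3*real k+8)*(6*real k+11)*(3*real k+7)/(4*(4*real k+11)*(4*real k+9)^2*(4*real k+7)))"
    proof -
      have "(3*p*q/2)*(3*p'*q'/2) / (a5*a4^2*a3) = 9*p*q*p'*q' / (4*a5*a4^2*a3)" for p q p' q' a5 a4 a3 :: real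
        by simp
      thus ?thesis unfolding \<rho>_def B Adefs .
    qed
    moreover have "b = (3*(6*real k+11)*(3*real k+7)/(2*(4*real k+9)*(4*real k+7)) + 3*(6*real k+7)*(3*real k+5)/(2*(4*real k+5)*(4*real k+7)))"
    proof -
      have "(3*p*q/2)/(a4*a3) + (3*p'*q'/2)/(a2*a3) = 3*p*q/(2*a4*a3) + 3*p'*q'/(2*a2*a3)"
        for p q p' q' a2 a3 a4 :: real
        by simp
      thus ?thesis unfolding b_def B Adefs .
    qed
    ultimately show ?thesis
      using poly_hyp_poly_rec[of x k] unfolding F2_def F1_def F0_def by simp
  qed
  \<comment> \<open>The factor \<open>u^4\<close> suffices to absorb every \<open>x\<close> through
    \<open>u * x = s\<close> and \<open>u * (1-x) = 1\<close>.\<close>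
  hence "u^4 * (x^2 * \<rho> * F2) = u^4 * (((1-x)^3 + b*x) * F1 - F0)" by simp
  moreover have ux: "u * x = s" "u * (1 - x) = 1" using u by (simp_all add: x_def s_def field_simps)
  have "u^4 * (x^2 * \<rho> * F2) = (u * x)^2 * u^2 * \<rho> * F2" by algebra
  hence "u^4 * (x^2 * \<rho> * F2) = s^2 * u^2 * \<rho> * F2" unfolding ux .
  moreover have "u^4 * (((1-x)^3 + b*x) * F1 - F0) = (u * (u * (1-x))^3 + b * (u*x) * u^3) * F1 - u^4 * F0"
    by algebra
  hence "u^4 * (((1-x)^3 + b*x) * F1 - F0) = (u + b * s * u^3) * F1 - u^4 * F0"
    unfolding ux by simp
  ultimately have main: "s^2 * u^2 * \<rho> * F2 = (u + b * s * u^3) * F1 - u^4 * F0" by simp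
  define d where "d = err_const k * s^(2*k+1) * u^k"
  define r1 r2 where "r1 = B3*B2/(A3*A2)" and "r2 = B5*B4/(A5*A4)"
  have D0: "D k = d * F0" by (simp add: D_def even_err_def d_def F0_def x_def s_def)
  have D1: "D (k+1) = d * r1 * s^2 * u * F1"
    by (simp add: D_def even_err_def d_def F1_def x_def s_def r1_def B2_def B3_def A2_def A3_def power2_eq_square)
  have D2: "D (k+2) = d * r1 * r2 * s^4 * u^2 * F2"
  proof -
    have "err_const (k+2) = err_const k * r1 * r2"
      by (simp add: r1_def r2_def B2_def B3_def B4_def B5_def Adefs numeral_eq_Suc add.commute)
    moreover have "s^(2*(k+2)+1) = s^(2*k+1) * s^4" "u^(k+2) = u^k * u^2"
      by (simp_all add: algebra_simps power_add power_numeral_reduce)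
    ultimately show ?thesis
      unfolding D_def even_err_def F2_def x_def s_def[symmetric] d_def by (simp only: mult_ac)
  qed
  have r2: "r2 = \<rho> * (A4 * A3)" using pos by (simp add: r2_def \<rho>_def field_simps power2_eq_square)
  have "D (k+2) = d * r1 * s^2 * A4 * A3 * (s^2 * u^2 * \<rho> * F2)"
    unfolding D2 r2 by (simp add: power_numeral_reduce)
  also have "\<dots> = d * r1 * s^2 * A4 * A3 * ((u + b * s * u^3) * F1 - u^4 * F0)" unfolding main ..
  also have "\<dots> = A4*A3*D (k+1) + (b*A4*A3) * z * D (k+1) - (r1 * A4*A3) * z^2 * D k"
    unfolding D0 D1 z by algebra
  also have "b*A4*A3 = B4 + B3*A4/A2" using pos by (simp add: b_def field_simps)
  also have "r1*A4*A3 = B3*B2*A4/A2" using pos by (simp add: r1_def field_simps)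
  finally show ?thesis
    unfolding A2_def[symmetric] A3_def[symmetric] A4_def[symmetric] B2_def[symmetric] B3_def[symmetric] B4_def[symmetric]
      divide_inverse
    by algebra
qed

text \<open>\<open>P\<close> and \<open>Q\<close> obey the same linear recurrence, hence so does
  \<open>P n - u * Q n\<close>. Induction proves both parities together, since the next pair of
  errors needs both members of the previous pair.\<close>

lemma gcf_err:
  fixes u :: real
  assumes u: "u \<noteq> 0"
  defines "z \<equiv> u^3 - u^2"
  defines "P \<equiv> gcf_num nalpha (\<lambda>n. nbeta n * z)"
  defines "Q \<equiv> gcf_den nalpha (\<lambda>n. nbeta n * z)"
  shows "P (2*k) - u * Q (2*k) = even_err u k"
    and "P (2*k+1) - u * Q (2*k+1) = (even_err u (k+1) - nbeta (2*k+2) * z * even_err u k) / (4*real k+5)"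
proof -
  define E where "E = (\<lambda>n. P n - u * Q n)"
  have E_rec: "E (n+2) = (2*real n+5) * E (n+1) + nbeta (n+2) * z * E n" for n
    by (simp add: E_def P_def Q_def algebra_simps)
  have hyp_poly_0: "hyp_poly 0 = 1" by (simp add: hyp_poly_def hyp_coeff_def)
  have poly_hyp_poly_1: "poly (hyp_poly (Suc 0)) x = 1 - x / 3" for x
    by (simp add: hyp_poly_def hyp_coeff_def poly_monom)
  have "E (2*k) = even_err u k \<and> E (2*k+1) = (even_err u (k+1) - nbeta (2*k+2) * z * even_err u k) / (4*real k+5)"
  proof (induction k)
    case 0
    have ev0: "even_err u 0 = 1 - u" by (simp add: even_err_def hyp_poly_0)
    have ev1: "even_err u (Suc 0) = -15 * (u-1)^3 * (2*u+1)"
      using u by (simp add: even_err_def poly_hyp_poly_1 nbeta_def field_simps power_numeral_reduce)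
    show ?case
      by (simp add: ev0 ev1 E_def P_def Q_def nbeta_def z_def) (simp add: algebra_simps power_numeral_reduce)
  next
    case (Suc k)
    have 1: "E (2*(k+1)) = even_err u (k+1)"
      using E_rec[of "2*k"] Suc by (simp add: field_simps)
    have "E (2*(k+1)+1) = (4*real k+7) * E (2*(k+1)) + nbeta (2*k+3) * z * E (2*k+1)"
      using E_rec[of "2*k+1"] by (simp add: algebra_simps numeral_eq_Suc)
    also have "\<dots> = (4*real k+7) * even_err u (k+1) + nbeta (2*k+3) * z * ((even_err u (k+1) - nbeta (2*k+2) * z * even_err u k) / (4*real k+5))"
      using 1 Suc by simp
    also have "\<dots> = (even_err u (k+2) - nbeta (2*k+4) * z * even_err u (k+1)) / (4*real k+9)"
      unfolding even_err_rec[OF u, of k, folded z_def] by simp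
    finally show ?case using 1 by (simp add: algebra_simps numeral_eq_Suc)
  qed
  thus "P (2*k) - u * Q (2*k) = even_err u k"
    and "P (2*k+1) - u * Q (2*k+1) = (even_err u (k+1) - nbeta (2*k+2) * z * even_err u k) / (4*real k+5)"
    by (simp_all add: E_def)
qed

text \<open>By \<open>nbeta_le\<close> and the inductive lower bound, the term with
  \<open>Q n\<close> in the recurrence is at most half of the main term
  \<open>(2*n+5) * Q (n+1)\<close>. Each ratio of successive denominators thus stays within
  \<open>1/2\<close> and \<open>3/2\<close> times the partial denominator.\<close>

lemma gcf_den_bounds:
  assumes z: "\<bar>z\<bar> \<le> 1/8"
  defines "Q \<equiv> gcf_den nalpha (\<lambda>n. nbeta n * z)"
  shows "Q n > 0" and "Q (n+1) \<ge> (2*real n+3)/2 * Q n" and "Q (n+1) \<le> 3/2 * (2*real n+3) * Q n"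
proof -
  have "Q n > 0 \<and> Q (n+1) \<ge> (2*real n+3)/2 * Q n \<and> Q (n+1) \<le> 3/2 * (2*real n+3) * Q n" for n
  proof (induction n)
    case (Suc n)
    hence pos: "Q n > 0" and lb: "(2*real n+3)/2 * Q n \<le> Q (Suc n)" by simp_all
    have pos': "Q (Suc n) > 0" using lb by (rule less_le_trans[rotated]) (use pos in simp)
    have rec: "Q (Suc (Suc n)) = (2*real n+5) * Q (Suc n) + nbeta (n+2) * z * Q n"
      by (simp add: Q_def algebra_simps)
    have "\<bar>nbeta (n+2) * z\<bar> \<le> (2 * (2 * real n + 5) * (2 * real n + 3)) * (1/8)"
      unfolding abs_mult using nbeta_le[of n] nbeta_nonneg[of "n+2"] z by (intro mult_mono) auto
    hence "\<bar>nbeta (n+2) * z * Q n\<bar> \<le> (2 * (2 * real n + 5) * (2 * real n + 3)) * (1/8) * Q n"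
      using pos unfolding abs_mult[of _ "Q n"] by (intro mult_mono) auto
    also have "\<dots> = (2 * real n + 5) / 2 * ((2*real n+3)/2 * Q n)" by (simp add: field_simps)
    also have "\<dots> \<le> (2 * real n + 5) / 2 * Q (Suc n)" by (intro mult_left_mono lb) auto
    finally have "\<bar>nbeta (n+2) * z * Q n\<bar> \<le> (2 * real n + 5) * Q (Suc n) / 2" by simp
    hence "Q (Suc (Suc n)) \<ge> (2 * real n + 5) * Q (Suc n) / 2"
      "Q (Suc (Suc n)) \<le> 3 * ((2 * real n + 5) * Q (Suc n)) / 2" unfolding rec by linarith+
    thus ?case using pos' by (simp add: algebra_simps)
  qed (simp add: Q_def)
  thus "Q n > 0" and "Q (n+1) \<ge> (2*real n+3)/2 * Q n" and "Q (n+1) \<le> 3/2 * (2*real n+3) * Q n"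
    by blast+
qed

text \<open>One step multiplies \<open>err_const\<close> by at most
  \<open>4*(4*k+5)*(4*k+3)\<close>, which is \<open>16\<close> times the growth
  \<open>(4*k+5)/2 * (4*k+3)/2\<close> guaranteed for \<open>Q\<close> over two steps.\<close>

lemma err_const_bound:
  assumes z: "\<bar>z\<bar> \<le> 1/8"
  defines "Q \<equiv> gcf_den nalpha (\<lambda>n. nbeta n * z)"
  shows "\<bar>err_const k\<bar> \<le> 16 ^ k * Q (2 * k)"
proof (induction k)
  case (Suc k)
  note Qb = gcf_den_bounds[OF z, folded Q_def]
  have prod: "nbeta (2*k+3) * nbeta (2*k+2) \<le> (2*(4*real k+7)*(4*real k+5)) * (2*(4*real k+5)*(4*real k+3))"
    using nbeta_le[of "2*k+1"] nbeta_le[of "2*k"] nbeta_nonneg[of "2*k+2"] nbeta_nonneg[of "2*k+3"]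
    by (intro mult_mono) (simp_all add: algebra_simps numeral_eq_Suc)
  have le: "nbeta (2*k+3) * nbeta (2*k+2) / ((4*real k+7) * (4*real k+5)) \<le> 4*(4*real k+5)*(4*real k+3)"
  proof -
    have "v / (p*q) \<le> 4*q*r" if "v \<le> (2*p*q)*(2*q*r)" "p > 0" "q > 0" for v p q r :: real
      using that by (simp add: pos_divide_le_eq mult_ac)
    from this[OF prod] show ?thesis by simp
  qed
  have "\<bar>err_const (Suc k)\<bar> = \<bar>err_const k\<bar> * (nbeta (2*k+3) * nbeta (2*k+2) / ((4*real k+7) * (4*real k+5)))"
    using nbeta_nonneg[of "2*k+2"] nbeta_nonneg[of "2*k+3"] by (simp add: abs_mult)
  also have "\<dots> \<le> (16 ^ k * Q (2*k)) * (4*(4*real k+5)*(4*real k+3))"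
    using Qb(1)[of "2*k"] nbeta_nonneg[of "2*k+2"] nbeta_nonneg[of "2*k+3"] by (intro mult_mono Suc le) auto
  also have "\<dots> = 16 ^ Suc k * ((4*real k+5)/2 * ((4*real k+3)/2 * Q (2*k)))" by simp
  also have "\<dots> \<le> 16 ^ Suc k * ((4*real k+5)/2 * Q (2*k+1))"
    using Qb(2)[of "2*k"] by (intro mult_left_mono) (simp_all add: algebra_simps)
  also have "\<dots> \<le> 16 ^ Suc k * Q (2*k+2)"
    using Qb(2)[of "2*k+1"] by (intro mult_left_mono) (simp_all add: algebra_simps)
  finally show ?case by simp
qed (simp add: Q_def)

lemma gcf_tendsto:
  fixes u :: real
  assumes u: "\<bar>u - 1\<bar> \<le> 1/10"
  defines "z \<equiv> u^3 - u^2"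
  defines "P \<equiv> gcf_num nalpha (\<lambda>n. nbeta n * z)"
  defines "Q \<equiv> gcf_den nalpha (\<lambda>n. nbeta n * z)"
  shows "Q n > 0" and "(\<lambda>n. P n / Q n) \<longlonglongrightarrow> u"
proof -
  define s where "s = u - 1"
  have u': "9/10 \<le> u" "u \<le> 11/10" using u by linarith+
  have "z = s * u^2" by (simp add: z_def s_def algebra_simps power2_eq_square power3_eq_cube)
  hence "\<bar>z\<bar> = \<bar>s\<bar> * u^2" by (simp add: abs_mult)
  also have "\<dots> \<le> 1/10 * (11/10)^2" using u u' by (intro mult_mono power_mono) (auto simp: s_def)
  finally have z: "\<bar>z\<bar> \<le> 1/8" by (simp add: power2_eq_square)
  note Qb = gcf_den_bounds[OF z, folded Q_def]
  show "Q n > 0" by (rule Qb)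
  have even: "\<bar>even_err u k\<bar> \<le> (1/2)^k * Q (2*k)" for k
  proof -
    have x: "\<bar>s / u\<bar> \<le> 1" using u u' by (simp add: s_def)
    have s2: "s^2 \<le> (1/10)^2" using u by (subst abs_le_square_iff[symmetric]) (simp add: s_def)
    have "\<bar>even_err u k\<bar> = \<bar>err_const k\<bar> * (\<bar>s\<bar> * (s^2) ^ k) * u ^ k * \<bar>poly (hyp_poly k) (s / u)\<bar>"
      using u' by (simp add: even_err_def abs_mult power_abs s_def power_mult)
    also have "\<dots> \<le> (16^k * Q (2*k)) * (1 * ((1/10)^2) ^ k) * (11/10) ^ k * 2 ^ k"
      using Qb(1)[of "2*k"] u' u
      by (intro mult_mono err_const_bound[OF z, folded Q_def] hyp_poly_bound x power_mono s2) (auto simp: s_def)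
    \<comment> \<open>The base is \<open>0.352\<close>: \<open>16\<close> comes from
      \<open>err_const\<close>, \<open>(1/10)^2\<close> from \<open>(u-1)^2\<close>,
      \<open>11/10\<close> from \<open>u\<close>, and \<open>2\<close> from the polynomial.\<close>
    also have "\<dots> = (16*(1/10)^2*(11/10)*2)^k * Q (2*k)"
      unfolding power_mult_distrib by simp
    also have "\<dots> \<le> (1/2)^k * Q (2*k)"
      using Qb(1)[of "2*k"] by (intro mult_right_mono power_mono) (auto simp: power2_eq_square)
    finally show ?thesis .
  qed
  \<comment> \<open>Even indices would allow the constant \<open>1\<close>; for odd ones the two
    even errors contribute \<open>3/4 + 1/2\<close>.\<close>
  have err: "\<bar>P n - u * Q n\<bar> \<le> 2 * (1/2)^(n div 2) * Q n" for n
  proof (cases "even n")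
    case True
    then obtain k where k: "n = 2*k" by blast
    have "(1/2)^k * Q (2*k) \<ge> 0" using Qb(1)[of "2*k"] by simp
    thus ?thesis using even[of k] gcf_err(1)[of u k] u' unfolding k P_def Q_def z_def by simp
  next
    case False
    then obtain k where k: "n = 2*k+1" by (auto elim: oddE)
    have up: "Q (2*k+2) \<le> 3/2*(4*real k+5) * Q (2*k+1)"
      using Qb(3)[of "2*k+1"] by (simp add: algebra_simps)
    have lo: "(4*real k+3)/2 * Q (2*k) \<le> Q (2*k+1)"
      using Qb(2)[of "2*k"] by (simp add: algebra_simps)
    have "\<bar>nbeta (2*k+2) * z\<bar> \<le> (2 * (4 * real k + 5) * (4 * real k + 3)) * (1/8)"
      unfolding abs_mult using nbeta_le[of "2*k"] nbeta_nonneg[of "2*k+2"] z by (intro mult_mono) auto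
    hence "\<bar>nbeta (2*k+2) * z * even_err u k\<bar> \<le> (2 * (4 * real k + 5) * (4 * real k + 3)) * (1/8) * ((1/2)^k * Q (2*k))"
      unfolding abs_mult[of _ "even_err u k"] by (intro mult_mono even) auto
    also have "\<dots> = (4*real k+5) / 2 * (1/2)^k * ((4*real k+3)/2 * Q (2*k))" by (simp add: field_simps)
    also have "\<dots> \<le> (4*real k+5) / 2 * (1/2)^k * Q (2*k+1)" by (intro mult_left_mono lo) auto
    finally have 1: "\<bar>nbeta (2*k+2) * z * even_err u k\<bar> \<le> (4*real k+5) / 2 * (1/2)^k * Q (2*k+1)" .
    have "\<bar>even_err u (k+1)\<bar> \<le> (1/2)^(k+1) * Q (2*k+2)" using even[of "k+1"] by simp
    also have "\<dots> \<le> (1/2)^(k+1) * (3/2*(4*real k+5) * Q (2*k+1))" by (intro mult_left_mono up) auto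
    finally have 2: "\<bar>even_err u (k+1)\<bar> \<le> (1/2)^(k+1) * (3/2*(4*real k+5) * Q (2*k+1))" .
    have "\<bar>even_err u (k+1) - nbeta (2*k+2) * z * even_err u k\<bar>
       \<le> (1/2)^(k+1) * (3/2*(4*real k+5) * Q (2*k+1)) + (4*real k+5) / 2 * (1/2)^k * Q (2*k+1)"
      using 1 2 by linarith
    also have "\<dots> = 5/4 * ((1/2)^k * Q (2*k+1)) * (4*real k+5)" by (simp add: field_simps)
    also have "\<dots> \<le> 2 * ((1/2)^k * Q (2*k+1)) * (4*real k+5)"
      using Qb(1)[of "2*k+1"] by (intro mult_right_mono) auto
    finally have "\<bar>even_err u (k+1) - nbeta (2*k+2) * z * even_err u k\<bar> / (4*real k+5) \<le> 2 * ((1/2)^k * Q (2*k+1))"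
      by (subst pos_divide_le_eq) auto
    moreover have "P n - u * Q n = (even_err u (k+1) - nbeta (2*k+2) * z * even_err u k) / (4*real k+5)"
      unfolding k P_def Q_def z_def by (rule gcf_err(2)) (use u' in auto)
    ultimately show ?thesis by (simp add: k abs_divide mult.assoc)
  qed
  have "(\<lambda>n. 2 * (1/2::real)^(n div 2)) \<longlonglongrightarrow> 2 * 0"
  proof (intro tendsto_mult tendsto_const filterlim_compose[OF LIMSEQ_power_zero])
    show "filterlim (\<lambda>n::nat. n div 2) sequentially sequentially"
      unfolding filterlim_at_top eventually_sequentially
      by (intro allI, rule_tac x = "2 * Z" in exI) auto
  qed simp
  moreover have "\<bar>P n / Q n - u\<bar> \<le> 2 * (1/2)^(n div 2)" for n
  proof -
    have "P n / Q n - u = (P n - u * Q n) / Q n" using Qb(1)[of n] by (simp add: field_simps)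
    thus ?thesis using err[of n] Qb(1)[of n] by (simp add: abs_divide pos_divide_le_eq)
  qed
  ultimately have "(\<lambda>n. P n / Q n - u) \<longlonglongrightarrow> 0"
    by (intro tendsto_0_le[of "\<lambda>n. 2 * (1/2::real)^(n div 2)" _ "\<lambda>n. P n / Q n - u" 1]) auto
  thus "(\<lambda>n. P n / Q n) \<longlonglongrightarrow> u" by (simp add: LIM_zero_iff)
qed

subsection \<open>Equivalence transformation\<close>

text \<open>Induction along the recurrences. Since \<open>\<alpha> 0\<close> is scaled too, the
  value is multiplied by \<open>c 0\<close>; placing \<open>c 0\<close> on the left of the second
  equation avoids division.\<close>

lemma gcf_equivalence_transformation:
  assumes "\<And>n. \<alpha>' n = c n * \<alpha> n" and "\<And>n. \<beta>' (Suc n) = c (Suc n) * c n * \<beta> (Suc n)"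
  shows "gcf_num \<alpha>' \<beta>' n = (\<Prod>i\<le>n. c i) * gcf_num \<alpha> \<beta> n"
    and "c 0 * gcf_den \<alpha>' \<beta>' n = (\<Prod>i\<le>n. c i) * gcf_den \<alpha> \<beta> n"
proof -
  show "gcf_num \<alpha>' \<beta>' n = (\<Prod>i\<le>n. c i) * gcf_num \<alpha> \<beta> n"
    by (induction n rule: induct_nat_012) (simp_all add: assms algebra_simps)
  show "c 0 * gcf_den \<alpha>' \<beta>' n = (\<Prod>i\<le>n. c i) * gcf_den \<alpha> \<beta> n"
  proof (induction n rule: induct_nat_012)
    case (ge2 n)
    have "c 0 * gcf_den \<alpha>' \<beta>' (Suc (Suc n)) = \<alpha>' (Suc (Suc n)) * (c 0 * gcf_den \<alpha>' \<beta>' (Suc n))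
        + \<beta>' (Suc (Suc n)) * (c 0 * gcf_den \<alpha>' \<beta>' n)"
      by (simp add: algebra_simps)
    also have "\<alpha>' (Suc (Suc n)) = c (Suc (Suc n)) * \<alpha> (Suc (Suc n))" by (rule assms)
    also have "\<beta>' (Suc (Suc n)) = c (Suc (Suc n)) * c (Suc n) * \<beta> (Suc (Suc n))" by (rule assms)
    finally show ?case unfolding ge2 by (simp add: algebra_simps)
  qed (simp_all add: assms algebra_simps)
qed

lemma of_int_gcf_num: "of_int (gcf_num \<alpha> \<beta> n) = gcf_num (\<lambda>n. of_int (\<alpha> n)) (\<lambda>n. of_int (\<beta> n)) n"
  by (induction \<alpha> \<beta> n rule: gcf_num.induct) simp_all

lemma of_int_gcf_den: "of_int (gcf_den \<alpha> \<beta> n) = gcf_den (\<lambda>n. of_int (\<alpha> n)) (\<lambda>n. of_int (\<beta> n)) n"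
  by (induction \<alpha> \<beta> n rule: gcf_den.induct) simp_all

text \<open>Neighbouring factors multiply to \<open>t^3\<close> or \<open>2 * t^3\<close>, which
  turns \<open>z\<close> into \<open>a\<close>. The extra \<open>2\<close> at
  \<open>n mod 4 = 3\<close> cancels the halves in \<open>nbeta (4*k+3)\<close> and
  \<open>nbeta (4*k+4)\<close>.\<close>

definition cubic_scale :: "real \<Rightarrow> nat \<Rightarrow> real" where
  "cubic_scale t n = (if even n then t else if n mod 4 = 3 then 2 * t\<^sup>2 else t\<^sup>2)"

lemma cubic_scale_simps:
  "cubic_scale t (4 * k) = t" "cubic_scale t (4 * k + 1) = t\<^sup>2"
  "cubic_scale t (4 * k + 2) = t" "cubic_scale t (4 * k + 3) = 2 * t\<^sup>2"
  "cubic_scale t (4 * k + 4) = t"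
proof -
  have "(4 * k + 1) mod 4 \<noteq> 3" "(4 * k + 3) mod 4 = 3" by presburger+
  thus "cubic_scale t (4 * k) = t" "cubic_scale t (4 * k + 1) = t\<^sup>2"
    "cubic_scale t (4 * k + 2) = t" "cubic_scale t (4 * k + 3) = 2 * t\<^sup>2"
    "cubic_scale t (4 * k + 4) = t"
    by (simp_all add: cubic_scale_def)
qed

lemma cubic_alpha_scale: "real_of_int (cubic_alpha t n) = cubic_scale t n * nalpha n"
proof -
  have "n = 0 \<or> (\<exists>k. n = 4*k+1 \<or> n = 4*k+2 \<or> n = 4*k+3 \<or> n = 4*k+4)" by presburger
  then consider "n = 0" | k where "n = 4*k+1" | k where "n = 4*k+2" | k where "n = 4*k+3" | k where "n = 4*k+4"
    by blast
  thus ?thesis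
  proof cases
    case 1 thus ?thesis by (simp add: cubic_alpha_eqs cubic_scale_def)
  next
    case 2 show ?thesis unfolding 2 cubic_alpha_eqs cubic_scale_simps by (simp add: algebra_simps)
  next
    case 3 show ?thesis unfolding 3 cubic_alpha_eqs cubic_scale_simps by (simp add: algebra_simps)
  next
    case 4 show ?thesis unfolding 4 cubic_alpha_eqs cubic_scale_simps by (simp add: algebra_simps)
  next
    case 5 show ?thesis unfolding 5 cubic_alpha_eqs cubic_scale_simps by (simp add: algebra_simps)
  qed
qed

lemma cubic_beta_scale:
  assumes "real_of_int a = t ^ 3 * z"
  shows "real_of_int (cubic_beta a (Suc n)) = cubic_scale t (Suc n) * cubic_scale t n * (nbeta (Suc n) * z)"
proof -
  have "\<exists>k. n = 4*k \<or> n = 4*k+1 \<or> n = 4*k+2 \<or> n = 4*k+3" by presburger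
  then consider k where "n = 4*k" | k where "n = 4*k+1" | k where "n = 4*k+2" | k where "n = 4*k+3"
    by blast
  thus ?thesis
  proof cases
    case (1 k)
    have S: "Suc n = 4*k+1" using 1 by simp
    show ?thesis unfolding S unfolding 1 cubic_beta_eqs cubic_scale_simps
      by (simp add: assms nbeta_def) (simp add: field_simps power2_eq_square power3_eq_cube)
  next
    case (2 k)
    have S: "Suc n = 4*k+2" using 2 by simp
    show ?thesis unfolding S unfolding 2 cubic_beta_eqs cubic_scale_simps
      by (simp add: assms nbeta_def) (simp add: field_simps power2_eq_square power3_eq_cube)
  next
    case (3 k)
    have S: "Suc n = 4*k+3" using 3 by simp
    show ?thesis unfolding S unfolding 3 cubic_beta_eqs cubic_scale_simps
      by (simp add: assms nbeta_def) (simp add: field_simps power2_eq_square power3_eq_cube)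
  next
    case (4 k)
    have S: "Suc n = 4*k+4" using 4 by simp
    show ?thesis unfolding S unfolding 4 cubic_beta_eqs cubic_scale_simps
      by (simp add: assms nbeta_def) (simp add: field_simps power2_eq_square power3_eq_cube)
  qed
qed

text \<open>Scaling by \<open>cubic_scale t\<close> leads back to the normalised fraction with limit
  \<open>u\<close>, and multiplies the value by \<open>cubic_scale t 0 = t\<close>.\<close>

lemma cubic_gcf_converges_to:
  fixes u :: real and t a :: int
  assumes t: "t \<noteq> 0" and u: "\<bar>u - 1\<bar> \<le> 1/10" and a: "of_int a = of_int t ^ 3 * (u^3 - u^2)"
  shows "gcf_converges_to (cubic_alpha t) (cubic_beta a) (of_int t * u)"
proof -
  define z where "z = u^3 - u^2"
  define c where "c = cubic_scale t"
  have c0: "c n \<noteq> 0" for n using t by (simp add: c_def cubic_scale_def)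
  have c_0: "c 0 = of_int t" by (simp add: c_def cubic_scale_def)
  let ?P = "gcf_num nalpha (\<lambda>n. nbeta n * z)" and ?Q = "gcf_den nalpha (\<lambda>n. nbeta n * z)"
  define w where "w n = (\<Prod>i\<le>n. c i)" for n
  have w: "w n \<noteq> 0" for n by (simp add: w_def c0)
  note transform = gcf_equivalence_transformation[of "\<lambda>n. of_int (cubic_alpha t n)" c nalpha
      "\<lambda>n. of_int (cubic_beta a n)" "\<lambda>n. nbeta n * z"]
  have num: "real_of_int (gcf_num (cubic_alpha t) (cubic_beta a) n) = w n * ?P n" for n
    unfolding of_int_gcf_num w_def c_def z_def
    by (intro transform(1)[unfolded c_def z_def] cubic_alpha_scale cubic_beta_scale a)
  have "c 0 * real_of_int (gcf_den (cubic_alpha t) (cubic_beta a) n) = w n * ?Q n" for n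
    unfolding of_int_gcf_den w_def c_def z_def
    by (intro transform(2)[unfolded c_def z_def] cubic_alpha_scale cubic_beta_scale a)
  hence den: "of_int t * real_of_int (gcf_den (cubic_alpha t) (cubic_beta a) n) = w n * ?Q n" for n
    unfolding c_0 .
  have Q: "?Q n > 0" for n using gcf_tendsto(1)[OF u] by (simp add: z_def)
  have "real_of_int (gcf_den (cubic_alpha t) (cubic_beta a) n) \<noteq> 0" for n
    using den[of n] w[of n] Q[of n] by auto
  hence nz: "gcf_den (cubic_alpha t) (cubic_beta a) n \<noteq> 0" for n by auto
  have "real_of_int (gcf_num (cubic_alpha t) (cubic_beta a) n) / real_of_int (gcf_den (cubic_alpha t) (cubic_beta a) n)
    = of_int t * (?P n / ?Q n)" for n
  proof -
    have "real_of_int (gcf_den (cubic_alpha t) (cubic_beta a) n) = w n * ?Q n / of_int t"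
      using den[of n] t by (simp add: field_simps)
    thus ?thesis using num[of n] w[of n] t by simp
  qed
  moreover have "(\<lambda>n. of_int t * (?P n / ?Q n)) \<longlonglongrightarrow> of_int t * u"
    using gcf_tendsto(2)[OF u] by (intro tendsto_mult tendsto_const) (simp add: z_def)
  ultimately show ?thesis using nz by (simp add: gcf_converges_to_def)
qed

subsection \<open>Moving a cubic irrational into the region of convergence\<close>

text \<open>Every rational \<open>r\<close> turns \<open>1 / (x - r)\<close> into a root \<open>w\<close> of a depressed cubic by a rational
  shift. The root is small compared with \<open>sqrt \<bar>p\<bar>\<close> when \<open>r\<close> is near the harmonic conjugate
  \<open>x - 2 f1 / f2\<close> of \<open>x\<close> with respect to the other two roots, where \<open>f1\<close> and \<open>f2\<close> are the Taylor
  coefficients of the cubic at \<open>x\<close>.\<close>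
lemma cubic_good_depression:
  fixes x :: real
  assumes rat: "c0 \<in> \<rat>" "c1 \<in> \<rat>" "c2 \<in> \<rat>" "D \<in> \<rat>" and D: "D \<noteq> 0"
    and root: "D * x^3 + c2 * x^2 + c1 * x + c0 = 0"
    and irr: "\<forall>a\<in>\<rat>. \<forall>b\<in>\<rat>. \<forall>c\<in>\<rat>. a * x^2 + b * x + c = 0 \<longrightarrow> a = 0 \<and> b = 0"
  obtains r \<beta> p q w :: real
  where "r \<in> \<rat>" "\<beta> \<in> \<rat>" "p \<in> \<rat>" "q \<in> \<rat>" "x \<noteq> r" "w = 1 / (x - r) + \<beta>"
    "w \<noteq> 0" "p \<noteq> 0" "w^3 + p * w + q = 0" "\<bar>w^2 / p\<bar> \<le> 1/10"
proof -
  define f1 where "f1 = 3*D*x^2 + 2*c2*x + c1"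
  define f2 where "f2 = 3*D*x + c2"
  \<comment> \<open>For \<open>r = x + s\<close> the cubic takes the value \<open>s * g s\<close> at
    \<open>r\<close>, and \<open>H s\<close> will turn out to be \<open>3*A^2*p\<close>.\<close>
  define H where "H s = - (f1^2) - f1*f2*s + (3*D*f1 - f2^2)*s^2" for s
  define g where "g s = f1 + f2*s + D*s^2" for s
  note nq = irr[rule_format]
  have f1: "f1 \<noteq> 0" using nq[of "3*D" "2*c2" c1] D by (auto simp: f1_def rat)
  have f2: "f2 \<noteq> 0" using nq[of 0 "3*D" c2] D by (auto simp: f2_def rat)
  \<comment> \<open>The discriminant of the quadratic cofactor \<open>g\<close>; its vanishing would
    be a rational quadratic equation for \<open>x\<close>.\<close>
  have disc: "f2^2 - 4*D*f1 \<noteq> 0"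
  proof
    assume "f2^2 - 4*D*f1 = 0"
    hence "(-3*D^2) * x^2 + (-2*D*c2) * x + (c2^2 - 4*D*c1) = 0"
      unfolding f1_def f2_def by algebra
    thus False using nq[of "-3*D^2" "-2*D*c2" "c2^2 - 4*D*c1"] D by (simp add: rat)
  qed
  \<comment> \<open>At \<open>s0\<close> the expression \<open>2*f1 + f2*s\<close>, which is
    \<open>-3*A*w\<close>, vanishes, while \<open>H\<close> and \<open>g\<close> do not. The
    required inequality is therefore strict at \<open>x + s0\<close> and persists at a nearby
    rational \<open>r\<close>.\<close>
  define s0 where "s0 = -2*f1/f2"
  have s0f2: "s0 * f2 = -2*f1" using f2 by (simp add: s0_def)
  have s0: "s0 \<noteq> 0" using f1 f2 by (simp add: s0_def)
  have "f2^2 * H s0 = -3 * f1^2 * (f2^2 - 4*D*f1)" unfolding H_def using s0f2 by algebra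
  hence H0: "H s0 \<noteq> 0" using f1 disc by auto
  have "f2^2 * g s0 = - f1 * (f2^2 - 4*D*f1)" unfolding g_def using s0f2 by algebra
  hence g0: "g s0 \<noteq> 0" using f1 disc by auto
  define S where "S = {r. 10 * (2*f1 + f2*(r-x))^2 < 3 * \<bar>H (r-x)\<bar>} \<inter> {r. g (r-x) \<noteq> 0} \<inter> {r. r \<noteq> x}"
  have "open S" unfolding S_def H_def g_def
    by (intro open_Int open_Collect_less open_Collect_neq continuous_intros)
  moreover have "x + s0 \<in> S" using H0 g0 s0 s0f2 by (simp add: S_def mult.commute)
  ultimately obtain e where e: "e > 0" "\<And>y. dist y (x+s0) < e \<Longrightarrow> y \<in> S"
    unfolding open_dist by blast
  obtain r where r: "r \<in> \<rat>" "x + s0 < r" "r < x + s0 + e"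
    using Rats_dense_in_real[of "x+s0" "x+s0+e"] e by auto
  hence "r \<in> S" by (intro e(2)) (simp add: dist_real_def)
  define s where "s = r - x"
  from \<open>r \<in> S\<close> have s: "10 * (2*f1+f2*s)^2 < 3 * \<bar>H s\<bar>" "g s \<noteq> 0" "s \<noteq> 0"
    by (auto simp: S_def s_def)
  \<comment> \<open>\<open>A\<close>, \<open>B\<close>, \<open>C\<close>, \<open>D\<close> are the
    Taylor coefficients of the cubic at \<open>r\<close>, so \<open>v = 1/(x-r)\<close> is a root of
    the reversed cubic. Adding \<open>\<beta>\<close> removes its quadratic term and leaves
    \<open>p\<close> and \<open>q\<close>.\<close>
  define A where "A = D*r^3 + c2*r^2 + c1*r + c0"
  define B where "B = 3*D*r^2 + 2*c2*r + c1"
  define C where "C = 3*D*r + c2"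
  define v where "v = 1 / (x - r)"
  define \<beta> where "\<beta> = B / (3*A)"
  define p where "p = (3*A*C - B^2) / (3*A^2)"
  define q where "q = (2*B^3 - 9*A*B*C + 27*A^2*D) / (27*A^3)"
  define w where "w = v + \<beta>"
  have rs: "r = x + s" by (simp add: s_def)
  have As: "A = s * g s" using root unfolding A_def g_def f1_def f2_def rs by algebra
  have Bs: "B = f1 + 2*f2*s + 3*D*s^2" unfolding B_def f1_def f2_def rs by algebra
  have Cs: "C = f2 + 3*D*s" unfolding C_def f2_def rs by algebra
  have A0: "A \<noteq> 0" using As s by simp
  have sv: "s * v = -1" using s by (simp add: v_def s_def field_simps)
  have Aw: "3*A*w = - (2*f1 + f2*s)"
  proof -
    have "3*A*w = 3*A*v + B" using A0 by (simp add: w_def \<beta>_def field_simps)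
    also have "\<dots> = - (2*f1 + f2*s)" unfolding As Bs g_def using sv by algebra
    finally show ?thesis .
  qed
  have Ap: "3*A^2*p = H s"
  proof -
    have "3*A^2*p = 3*A*C - B^2" using A0 by (simp add: p_def)
    also have "\<dots> = H s" unfolding As Bs Cs H_def g_def by algebra
    finally show ?thesis .
  qed
  \<comment> \<open>For rational \<open>r\<close> this is a rational quadratic in \<open>x\<close>
    with leading coefficient \<open>3*D\<close>, so \<open>w\<close> is small but not zero.\<close>
  have "2*f1 + f2*s = (3*D)*x^2 + (3*c2+3*D*r)*x + (2*c1+c2*r)"
    unfolding f1_def f2_def s_def by algebra
  hence "2*f1 + f2*s \<noteq> 0" using nq[of "3*D" "3*c2+3*D*r" "2*c1+c2*r"] D by (auto simp: rat r)
  hence w0: "w \<noteq> 0" using Aw by auto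
  have "H s \<noteq> 0" using s(1) by auto
  hence p0: "p \<noteq> 0" using Ap by auto
  have "10 * (3*A*w)^2 < 3 * \<bar>3*A^2*p\<bar>" unfolding Aw Ap power2_minus using s(1) .
  hence "9*A^2 * (10 * w^2) < 9*A^2 * \<bar>p\<bar>" by (simp add: power_mult_distrib abs_mult)
  hence "10 * w^2 < \<bar>p\<bar>" by (rule mult_left_less_imp_less) simp
  hence small: "\<bar>w^2 / p\<bar> \<le> 1/10" using p0 by (simp add: abs_divide divide_simps)
  have cub: "A*v^3 + B*v^2 + C*v + D = 0"
    using sv unfolding As Bs Cs g_def by algebra
  have "27*A^3 * (w^3 + p*w + q) = 27*A^2*(A*v^3 + B*v^2 + C*v + D)"
  proof -
    have 1: "3*A*\<beta> = B" "3*A^2*p = 3*A*C - B^2" "27*A^3*q = 2*B^3 - 9*A*B*C + 27*A^2*D"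
      using A0 by (simp_all add: \<beta>_def p_def q_def)
    have "27*A^3 * (w^3 + p*w + q) = (3*A*v+3*A*\<beta>)^3 + 3*(3*A^2*p)*(3*A*v+3*A*\<beta>) + 27*A^3*q"
      unfolding w_def by algebra
    also have "\<dots> = 27*A^2*(A*v^3 + B*v^2 + C*v + D)" unfolding 1 by algebra
    finally show ?thesis .
  qed
  hence "w^3 + p*w + q = 0" using cub A0 by simp
  moreover have "\<beta> \<in> \<rat>" "p \<in> \<rat>" "q \<in> \<rat>"
    by (simp_all add: \<beta>_def p_def q_def A_def B_def C_def rat r)
  ultimately show thesis
    using that[of r \<beta> p q w] r(1) s(3) w0 p0 small by (simp add: w_def v_def s_def)
qed

section \<open>From the depressed cubic to integer parameters\<close>

theorem theorem3:
  fixes x :: real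
  assumes "algebraic x" and "algebraic_degree x = 3"
  shows "\<exists>m1 m2 m3 m4 t0 a0 :: int.
           m1 * m4 - m2 * m3 \<noteq> 0 \<and> a0 \<noteq> 0 \<and>
           gcf_converges_to (cubic_alpha t0) (cubic_beta a0)
             ((of_int m1 * x + of_int m2) / (of_int m3 * x + of_int m4))"
proof -
  define Pr where "Pr d \<longleftrightarrow> (\<exists>p. (\<forall>i. coeff p i \<in> \<rat>) \<and> p \<noteq> 0 \<and> poly p x = 0 \<and> degree p = d)" for d
  have deg: "(LEAST d. Pr d) = 3" using assms(2) by (simp add: algebraic_degree_def Pr_def)
  have "\<exists>d. Pr d" using assms(1) by (auto simp: algebraic_altdef Pr_def)
  hence "Pr 3" using LeastI_ex[of Pr] deg by simp
  then obtain f where f: "\<forall>i. coeff f i \<in> \<rat>" "poly f x = 0" "degree f = 3" by (auto simp: Pr_def)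
  have min: "\<not> Pr d" if "d < 3" for d using not_less_Least[of d Pr] that deg by simp
  have root: "coeff f 3 * x^3 + coeff f 2 * x^2 + coeff f 1 * x + coeff f 0 = 0"
    using f(2) unfolding poly_altdef f(3) by (simp add: numeral_eq_Suc algebra_simps)
  have lc: "coeff f 3 \<noteq> 0" using f(3) by (metis leading_coeff_0_iff degree_0 zero_neq_numeral)
  have nq: "a = 0 \<and> b = 0" if "a \<in> \<rat>" "b \<in> \<rat>" "c \<in> \<rat>" "a * x^2 + b * x + c = 0" for a b c
  proof (rule ccontr)
    assume *: "\<not> ?thesis"
    have "\<forall>i. coeff [:c, b, a:] i \<in> \<rat>" using that by (auto simp: coeff_pCons split: nat.split)
    moreover have "poly [:c, b, a:] x = 0" using that(4) by (simp add: algebra_simps power2_eq_square)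
    ultimately have "Pr (degree [:c, b, a:])" unfolding Pr_def using * by (intro exI[of _ "[:c, b, a:]"]) auto
    moreover have "degree [:c, b, a:] < 3" by simp
    ultimately show False using min by blast
  qed
  hence irr: "\<forall>a\<in>\<rat>. \<forall>b\<in>\<rat>. \<forall>c\<in>\<rat>. a * x^2 + b * x + c = 0 \<longrightarrow> a = 0 \<and> b = 0" by blast
  obtain r \<beta> p q w where *: "r \<in> \<rat>" "\<beta> \<in> \<rat>" "p \<in> \<rat>" "q \<in> \<rat>" "x \<noteq> r" "w = 1 / (x - r) + \<beta>"
    "w \<noteq> 0" "p \<noteq> 0" "w^3 + p * w + q = 0" "\<bar>w^2 / p\<bar> \<le> 1/10"
    by (rule cubic_good_depression[OF f(1)[rule_format] f(1)[rule_format] f(1)[rule_format] f(1)[rule_format] lc root irr])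
  \<comment> \<open>From \<open>w * (w^2 + p) = -q\<close> follows \<open>1/w = -(p/q) * u\<close>.
    Hence \<open>l/w = t*u\<close> for \<open>t = -p*l/q\<close>, and then
    \<open>t^3 * (u^3 - u^2) = -l^3/q\<close>, the value chosen for \<open>a\<close>.\<close>
  define u where "u = 1 + w^2 / p"
  have u: "\<bar>u - 1\<bar> \<le> 1/10" using *(10) by (simp add: u_def)
  hence u0: "u > 0" by linarith
  have "p * u = p + w^2" using *(8) by (simp add: u_def field_simps)
  hence qu: "q = - (w * p * u)" using *(9) by algebra
  hence q0: "q \<noteq> 0" using u0 *(7,8) by simp
  have int_frac: "\<exists>n d :: int. d \<noteq> 0 \<and> y = of_int n / of_int d" if "y \<in> \<rat>" for y :: real
  proof -
    obtain n d where "d > 0" "y = of_int n / of_int d" using \<open>y \<in> \<rat>\<close> by (rule Rats_cases')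
    thus ?thesis by (intro exI[of _ n] exI[of _ d]) simp
  qed
  obtain n1 d1 where 1: "d1 \<noteq> 0" "p / q = of_int n1 / of_int d1" using int_frac[of "p/q"] * by auto
  obtain n2 d2 where 2: "d2 \<noteq> 0" "1 / q = of_int n2 / of_int d2" using int_frac[of "1/q"] * by auto
  obtain n3 d3 where 3: "d3 \<noteq> 0" "r = of_int n3 / of_int d3" using int_frac[of r] * by auto
  obtain n4 d4 where 4: "d4 \<noteq> 0" "\<beta> = of_int n4 / of_int d4" using int_frac[of \<beta>] * by auto
  \<comment> \<open>A common multiple of the denominators of \<open>p/q\<close> and
    \<open>1/q\<close>, which makes \<open>-p*l/q\<close> and \<open>-l^3/q\<close>
    integers.\<close>
  define l where "l = d1 * d2"
  define t where "t = - (n1 * d2)"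
  define a where "a = - (l^2 * d1 * n2)"
  have l0: "l \<noteq> 0" using 1 2 by (simp add: l_def)
  have tr: "real_of_int t = - (p * l / q)"
  proof -
    have "p * l / q = (p / q) * d1 * d2" by (simp add: l_def)
    thus ?thesis unfolding 1(2) using 1(1) by (simp add: t_def)
  qed
  have ar: "real_of_int a = - (l^3 / q)"
  proof -
    have "l^3 / q = l^2 * d1 * ((1 / q) * d2)" by (simp add: l_def power_numeral_reduce)
    thus ?thesis unfolding 2(2) using 2(1) by (simp add: a_def)
  qed
  have t0: "t \<noteq> 0" using tr *(8) q0 l0 by auto
  have a0: "a \<noteq> 0" using ar q0 l0 by auto
  have y: "of_int t * u = l / w"
    unfolding tr qu using *(7,8) u0 by (simp add: field_simps)
  have "of_int t ^ 3 * (u^3 - u^2) = (of_int t * u)^2 * of_int t * (u - 1)"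
    by (simp add: algebra_simps power_numeral_reduce)
  also have "\<dots> = of_int a"
  proof -
    have "u - 1 = w^2 / p" by (simp add: u_def)
    thus ?thesis unfolding y unfolding tr ar using *(7,8) q0 by (simp add: power_divide power_numeral_reduce)
  qed
  finally have conv: "gcf_converges_to (cubic_alpha t) (cubic_beta a) (l / w)"
    using cubic_gcf_converges_to[OF t0 u, of a] unfolding y by simp
  \<comment> \<open>The coefficients of \<open>l/w = l*(x-r) / (1 + \<beta>*(x-r))\<close> after
    multiplying numerator and denominator by \<open>d3*d4\<close>.\<close>
  define m1 m2 m3 m4 where "m1 = l*d3*d4" and "m2 = -l*n3*d4" and "m3 = n4*d3" and "m4 = d3*d4 - n3*n4"
  have det: "m1*m4 - m2*m3 = l * (d3*d4)^2"
    unfolding m1_def m2_def m3_def m4_def by (simp add: algebra_simps power2_eq_square)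
  have m12: "of_int m1 * x + of_int m2 = of_int (d3*d4) * (l * (x - r))"
    using 3(1) by (simp add: m1_def m2_def 3(2) field_simps)
  have m34: "of_int m3 * x + of_int m4 = of_int (d3*d4) * (1 + \<beta> * (x - r))"
    using 3(1) 4(1) by (simp add: m3_def m4_def 3(2) 4(2) field_simps)
  have "(of_int m1 * x + of_int m2) / (of_int m3 * x + of_int m4) = l * (x - r) / (1 + \<beta> * (x - r))"
    unfolding m12 m34 using 3(1) 4(1) by simp
  also have "1 + \<beta> * (x - r) = w * (x - r)" using *(5,6) by (simp add: field_simps)
  also have "l * (x - r) / (w * (x - r)) = l / w" using *(5) by simp
  finally have "gcf_converges_to (cubic_alpha t) (cubic_beta a) ((of_int m1 * x + of_int m2) / (of_int m3 * x + of_int m4))"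
    using conv by simp
  moreover have "m1*m4 - m2*m3 \<noteq> 0" unfolding det using l0 3(1) 4(1) by simp
  ultimately show ?thesis using a0 by (intro exI conjI)
qed

end
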